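(* There exists a first countable functionally Hausdorff Type I space $T$ which is not f-Type I.
   Context: "Space" means Hausdorff topological space. The longray $\mathbb{L}_{\ge 0}$ is $\omega_1\times[0,1)$ with the lexicographic order topology; $\alpha\in\omega_1$ is identified with $\langle\alpha,0\rangle$. A space $T$ is functionally Hausdorff if for any distinct $x,y\in T$ there is a continuous $f:T\to\mathbb{R}$ with $f(x)=0$ and $f(y)=1$. A space $T$ is Type I (in itself) if there is an open cover $\{U_\alpha:\alpha\in\omega_1\}$ of $T$ with $\overline{U_\alpha}\subset U_\beta$ whenever $\alpha<\beta$ and with each $\overline{U_\alpha}$ Lindelöf. $T$ is f-Type I (functionally Type I, in itself) if there is a continuous $s:T\to\mathbb{L}_{\ge 0}$ such that $s^{-1}([0,\alpha])$ is Lindelöf for each $\alpha\in\omega_1$. *)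

theory Defs
  imports "HOL-Analysis.Analysis"
begin

text \<open>
  The ordinal \<open>\<omega>\<^sub>1\<close> as a type: the library's cardinal successor of the well-order \<^const>\<open>natLeq\<close> of
  the natural numbers.  The two lemmas after the instance confirm that it is an uncountable
  well-order with countable proper initial segments.
\<close>

typedef omega1 = "Field (cardSuc natLeq)"
proof -
  have "infinite (Field (cardSuc natLeq))"
    using cardSuc_finite[OF natLeq_Card_order] by (simp add: Field_natLeq)
  then show ?thesis
    by (metis finite.emptyI equals0I)
qed

instantiation omega1 :: wellorder
begin

definition less_eq_omega1 :: "omega1 \<Rightarrow> omega1 \<Rightarrow> bool" where
  "x \<le> y \<longleftrightarrow> (Rep_omega1 x, Rep_omega1 y) \<in> cardSuc natLeq"

definition less_omega1 :: "omega1 \<Rightarrow> omega1 \<Rightarrow> bool" where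
  "x < y \<longleftrightarrow> x \<le> y \<and> \<not> y \<le> (x :: omega1)"

instance
proof -
  have wo: "Well_order (cardSuc natLeq)"
    using cardSuc_Card_order[OF natLeq_Card_order] card_order_on_def by blast
  have refl: "x \<le> x" for x :: omega1
    using wo Rep_omega1[of x]
    unfolding less_eq_omega1_def well_order_on_def linear_order_on_def partial_order_on_def
      preorder_on_def refl_on_def by blast
  have trans: "x \<le> z" if "x \<le> y" "y \<le> z" for x y z :: omega1
    using wo that
    unfolding less_eq_omega1_def well_order_on_def linear_order_on_def partial_order_on_def
      preorder_on_def trans_def by blast
  have antisym: "x = y" if "x \<le> y" "y \<le> x" for x y :: omega1
    using wo that Rep_omega1_inject[of x y]
    unfolding less_eq_omega1_def well_order_on_def linear_order_on_def partial_order_on_def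
      antisym_def by blast
  have total: "x \<le> y \<or> y \<le> x" for x y :: omega1
    using wo refl[of x] Rep_omega1[of x] Rep_omega1[of y] Rep_omega1_inject[of x y]
    unfolding less_eq_omega1_def well_order_on_def linear_order_on_def total_on_def by metis
  have wf: "wf (cardSuc natLeq - Id)"
    using wo unfolding well_order_on_def by blast
  have "{(x, y). x < (y :: omega1)} \<subseteq> inv_image (cardSuc natLeq - Id) Rep_omega1"
    using refl by (auto simp: less_omega1_def less_eq_omega1_def inv_image_def Rep_omega1_inject)
  then have wfless: "wf {(x, y). x < (y :: omega1)}"
    using wf_subset wf_inv_image[OF wf] by blast
  show "OFCLASS(omega1, wellorder_class)"
  proof
    fix x y z :: omega1 and P :: "omega1 \<Rightarrow> bool"
    show "x < y \<longleftrightarrow> x \<le> y \<and> \<not> y \<le> x" by (rule less_omega1_def)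
    show "x \<le> x" by (rule refl)
    show "x \<le> y \<Longrightarrow> y \<le> z \<Longrightarrow> x \<le> z" by (rule trans)
    show "x \<le> y \<Longrightarrow> y \<le> x \<Longrightarrow> x = y" by (rule antisym)
    show "x \<le> y \<or> y \<le> x" by (rule total)
    show "P x" if "\<And>x. (\<And>y. y < x \<Longrightarrow> P y) \<Longrightarrow> P x"
      using wfless that by (induction x rule: wf_induct_rule) auto
  qed
qed

end

lemma countable_iff_ordLeq_natLeq:
  includes cardinal_syntax
  shows "countable A \<longleftrightarrow> |A| \<le>o natLeq"
proof -
  have "countable A \<longleftrightarrow> |A| \<le>o |UNIV :: nat set|"
    unfolding countable_def card_of_ordLeq[symmetric] by simp
  then show ?thesis
    using card_of_nat ordLeq_ordIso_trans ordIso_symmetric by blast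
qed

lemma uncountable_omega1:
  includes cardinal_syntax
  shows "uncountable (UNIV :: omega1 set)"
proof
  assume "countable (UNIV :: omega1 set)"
  then have "countable (Field (cardSuc natLeq))"
    by (metis countable_image type_definition.Rep_range type_definition_omega1)
  then have "|Field (cardSuc natLeq)| \<le>o natLeq"
    by (simp add: countable_iff_ordLeq_natLeq)
  then have "cardSuc natLeq \<le>o natLeq"
    using card_of_Field_ordIso[OF cardSuc_Card_order[OF natLeq_Card_order]]
      ordIso_ordLeq_trans ordIso_symmetric by blast
  then show False
    using cardSuc_greater[OF natLeq_Card_order] not_ordLess_ordLeq by blast
qed

lemma countable_lessThan_omega1:
  includes cardinal_syntax
  shows "countable {..<\<alpha> :: omega1}"
proof -
  let ?r = "cardSuc natLeq"
  have co: "Card_order ?r" by (rule cardSuc_Card_order[OF natLeq_Card_order])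
  have "|underS ?r (Rep_omega1 \<alpha>)| <o ?r"
    using card_of_underS[OF co Rep_omega1] .
  then have "|underS ?r (Rep_omega1 \<alpha>)| \<le>o natLeq"
    using cardSuc_ordLeq_ordLess[OF natLeq_Card_order card_of_Card_order] by blast
  then have "countable (underS ?r (Rep_omega1 \<alpha>))"
    by (simp add: countable_iff_ordLeq_natLeq)
  moreover have "Rep_omega1 ` {..<\<alpha>} \<subseteq> underS ?r (Rep_omega1 \<alpha>)"
    by (auto simp: underS_def less_omega1_def less_eq_omega1_def Rep_omega1_inject)
  ultimately show ?thesis
    by (meson Rep_omega1_inject countable_image_inj_on countable_subset inj_onI)
qed

text \<open>The longray \<open>\<omega>\<^sub>1 \<times> [0,1)\<close> with the lexicographic order and its order topology.\<close>

typedef longray = "(UNIV :: omega1 set) \<times> {0..<1 :: real}"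
  by (intro exI[of _ "(undefined, 0)"]) auto

instantiation longray :: linorder
begin

definition less_eq_longray :: "longray \<Rightarrow> longray \<Rightarrow> bool" where
  "p \<le> q \<longleftrightarrow> fst (Rep_longray p) < fst (Rep_longray q) \<or>
     fst (Rep_longray p) = fst (Rep_longray q) \<and> snd (Rep_longray p) \<le> snd (Rep_longray q)"

definition less_longray :: "longray \<Rightarrow> longray \<Rightarrow> bool" where
  "p < q \<longleftrightarrow> p \<le> q \<and> \<not> q \<le> (p :: longray)"

instance
proof
  fix x y z :: longray
  show "x < y \<longleftrightarrow> x \<le> y \<and> \<not> y \<le> x" by (rule less_longray_def)
  show "x \<le> x" by (simp add: less_eq_longray_def)
  show "x \<le> y \<Longrightarrow> y \<le> z \<Longrightarrow> x \<le> z" by (auto simp: less_eq_longray_def)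
  show "x \<le> y \<Longrightarrow> y \<le> x \<Longrightarrow> x = y"
    by (auto simp: less_eq_longray_def Rep_longray_inject[symmetric] prod_eq_iff)
  show "x \<le> y \<or> y \<le> x" by (auto simp: less_eq_longray_def)
qed

end

instantiation longray :: order_topology
begin

definition open_longray :: "longray set \<Rightarrow> bool" where
  "open_longray =
     generate_topology (range (\<lambda>a. {..<a :: longray}) \<union> range (\<lambda>a. {a<..}))"

instance
  by standard (rule open_longray_def)

end

definition longray_of_omega1 :: "omega1 \<Rightarrow> longray" where
  "longray_of_omega1 \<alpha> = Abs_longray (\<alpha>, 0)"

lemma Rep_longray_of_omega1: "Rep_longray (longray_of_omega1 \<alpha>) = (\<alpha>, 0)"
  by (simp add: longray_of_omega1_def Abs_longray_inverse)

definition functionally_Hausdorff_space :: "'a topology \<Rightarrow> bool" where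
  "functionally_Hausdorff_space T \<longleftrightarrow>
     (\<forall>x \<in> topspace T. \<forall>y \<in> topspace T. x \<noteq> y \<longrightarrow>
        (\<exists>f :: 'a \<Rightarrow> real. continuous_map T euclideanreal f \<and> f x = 0 \<and> f y = 1))"

definition type_I_space :: "'a topology \<Rightarrow> bool" where
  "type_I_space T \<longleftrightarrow>
     (\<exists>U :: omega1 \<Rightarrow> 'a set.
        (\<forall>\<alpha>. openin T (U \<alpha>)) \<and>
        (\<Union>\<alpha>. U \<alpha>) = topspace T \<and>
        (\<forall>\<alpha> \<beta>. \<alpha> < \<beta> \<longrightarrow> T closure_of U \<alpha> \<subseteq> U \<beta>) \<and>
        (\<forall>\<alpha>. Lindelof_space (subtopology T (T closure_of U \<alpha>))))"

text \<open>
  The initial segment \<open>[0,\<alpha>]\<close> of the longray is \<open>{..longray_of_omega1 \<alpha>}\<close>, as the longray has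
  least element \<open>0\<close>.
\<close>

definition f_type_I_space :: "'a topology \<Rightarrow> bool" where
  "f_type_I_space T \<longleftrightarrow>
     (\<exists>s :: 'a \<Rightarrow> longray.
        continuous_map T euclidean s \<and>
        (\<forall>\<alpha>. Lindelof_space
               (subtopology T {x \<in> topspace T. s x \<in> {..longray_of_omega1 \<alpha>}})))"

text \<open>
  An existence statement about such spaces may take its points from the type \<^typ>\<open>real\<close> (used only
  as a set, with an arbitrary topology on an arbitrary subset).  By Arhangelskii's theorem, a first
  countable Hausdorff Lindelof space has at most continuum many points; hence so does a first
  countable Hausdorff Type I space, as a union of \<open>\<aleph>\<^sub>1\<close> many of them.
\<close>

end

(*
  The space refines the Euclidean topology on a subset of the reals, so it is functionally
  Hausdorff.  It is the union of disjoint countable dense sets D a, I a (a < omega_1), where the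
  points of I a are isolated and a basic neighbourhood of p in D a adds to p the points of the
  I b close to p, with b in an interval [c a n, a] shrinking to a.  The countable sets
  U a = (UN b <= a. D b Un I b) witness Type I.  Neighbourhoods of points of different layers
  meet, however, so a continuous map s into the longray is bounded on all of the D a by any
  bound for s on the countable first layer D 0.  As the D a are in no single U b, s does not
  witness f-Type I.
*)

theory Submission
  imports Defs
begin

section \<open>Boundedness and cardinality in omega_1\<close>

text \<open>Countably many countable initial segments cannot exhaust \<open>omega1\<close>, and any
  ordinal they miss is a bound.\<close>

lemma countable_bounded_above_omega1:
  fixes A :: "omega1 set"
  assumes "countable A"
  shows "\<exists>b. \<forall>a\<in>A. a \<le> b"
proof -
  have "(\<Union>a\<in>A. {..<a}) \<noteq> UNIV"
    using assms uncountable_omega1 countable_lessThan_omega1 countable_UN by metis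
  then obtain b where "\<forall>a\<in>A. \<not> b < a"
    by blast
  then show ?thesis
    by (auto simp: not_less)
qed

lemma omega1_not_top: "\<exists>b. a < (b :: omega1)"
proof (rule ccontr)
  assume "\<not> ?thesis"
  then have "UNIV = insert a {..<a}"
    by (auto simp: not_less order.order_iff_strict)
  then show False
    using uncountable_omega1 countable_lessThan_omega1[of a] by (metis countable_insert)
qed

text \<open>Aleph_1 is the least uncountable cardinal and absorbs a factor of two. The factor
  \<open>bool\<close> later gives two dense sets for each ordinal.\<close>

lemma omega1_inj_into_uncountable:
  includes cardinal_syntax
  assumes "uncountable A"
  obtains f :: "omega1 \<times> bool \<Rightarrow> 'a" where "inj f" "range f \<subseteq> A"
proof -
  have inf: "infinite (UNIV :: omega1 set)"
    using uncountable_omega1 uncountable_infinite by blast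
  have "|UNIV :: omega1 set| \<le>o |Field (cardSuc natLeq)|"
    by (rule card_of_ordLeqI[of Rep_omega1]) (auto simp: inj_on_def Rep_omega1_inject Rep_omega1)
  also have "|Field (cardSuc natLeq)| =o cardSuc natLeq"
    by (simp add: card_of_Field_ordIso cardSuc_Card_order natLeq_Card_order)
  also have "cardSuc natLeq \<le>o |A|"
  proof (rule cardSuc_least[OF natLeq_Card_order card_of_Card_order])
    show "natLeq <o |A|"
      using assms natLeq_Well_order card_of_Well_order
      by (metis countable_iff_ordLeq_natLeq not_ordLeq_iff_ordLess)
  qed
  finally have "|UNIV :: omega1 set| \<le>o |A|" .
  moreover have "|UNIV :: bool set| \<le>o |UNIV :: omega1 set|"
  proof (rule ordLess_imp_ordLeq[OF finite_ordLess_infinite])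
    show "finite (Field |UNIV :: bool set| )" "\<not> finite (Field |UNIV :: omega1 set| )"
      using inf by (simp_all add: Field_card_of)
  qed (rule card_of_Well_order)+
  then have "|(UNIV :: omega1 set) \<times> (UNIV :: bool set)| \<le>o |UNIV :: omega1 set|"
    using card_of_Times_infinite_simps(1)[OF inf UNIV_not_empty] ordIso_imp_ordLeq by blast
  ultimately have "|UNIV :: (omega1 \<times> bool) set| \<le>o |A|"
    using ordLeq_transitive by fastforce
  then show thesis
    using that by (auto simp: card_of_ordLeq[symmetric])
qed

section \<open>Disjoint dense sets and ladders\<close>

text \<open>Cosets of the rationals serve: each is countable and dense, distinct ones are disjoint,
  and there are uncountably many because countably many countable sets cannot cover the
  line.\<close>

lemma disjoint_countable_dense_sets:
  obtains C :: "omega1 \<times> bool \<Rightarrow> real set"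
  where "disjoint_family C" "\<And>i. countable (C i)"
    "\<And>i x y. x < y \<Longrightarrow> \<exists>z\<in>C i. x < z \<and> z < y"
proof -
  define coset :: "real \<Rightarrow> real set" where "coset x = range (\<lambda>r. x + of_rat r)" for x
  have self: "x \<in> coset x" for x
    by (auto simp: coset_def image_iff intro!: exI[of _ 0])
  have eq: "coset x = coset y" if "z \<in> coset x" "z \<in> coset y" for x y z
  proof -
    have "coset u \<subseteq> coset v" if "u + of_rat q = v + of_rat r" for u v q r
    proof
      fix w assume "w \<in> coset u"
      then obtain t where "w = u + of_rat t" by (auto simp: coset_def)
      then have "w = v + of_rat (r - q + t)"
        using that by (simp add: of_rat_add of_rat_diff)
      then show "w \<in> coset v" by (auto simp: coset_def)
    qed
    moreover obtain q where "z = x + of_rat q" using \<open>z \<in> coset x\<close> unfolding coset_def by blast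
    moreover obtain r where "z = y + of_rat r" using \<open>z \<in> coset y\<close> unfolding coset_def by blast
    ultimately show ?thesis
      by (metis subset_antisym)
  qed
  have "uncountable (range coset)"
  proof
    assume "countable (range coset)"
    then have "countable (\<Union> (range coset))"
      by (rule countable_UN[of _ id, simplified]) (auto simp: coset_def)
    moreover have "\<Union> (range coset) = UNIV" using self by auto
    ultimately show False using uncountable_UNIV_real by simp
  qed
  then obtain C :: "omega1 \<times> bool \<Rightarrow> real set" where C: "inj C" "range C \<subseteq> range coset"
    by (rule omega1_inj_into_uncountable)
  show thesis
  proof
    show "disjoint_family C"
      unfolding disjoint_family_on_def
    proof (intro ballI impI)
      fix i j :: "omega1 \<times> bool" assume "i \<noteq> j"
      obtain x where x: "C i = coset x" using C(2) by blast
      obtain y where y: "C j = coset y" using C(2) by blast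
      show "C i \<inter> C j = {}"
        using eq[of _ x y] x y injD[OF C(1), of i j] \<open>i \<noteq> j\<close> by blast
    qed
    fix i :: "omega1 \<times> bool"
    obtain x where x: "C i = coset x" using C(2) by blast
    show "countable (C i)" by (simp add: x coset_def)
    fix u v :: real assume "u < v"
    then obtain r where "u - x < of_rat r" "of_rat r < v - x"
      using of_rat_dense[of "u - x" "v - x"] by auto
    then have "u < x + of_rat r" "x + of_rat r < v" by simp_all
    then show "\<exists>z\<in>C i. u < z \<and> z < v"
      by (auto simp: x coset_def)
  qed
qed

text \<open>Running maxima of an enumeration of the ordinals below \<open>a\<close> increase and
  eventually pass each of them. At a successor they end constant at its predecessor.\<close>

lemma omega1_ladder:
  obtains c :: "omega1 \<Rightarrow> nat \<Rightarrow> omega1"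
  where "\<And>a. mono (c a)" "\<And>a n. c a n \<le> a" "\<And>a b n. b < a \<Longrightarrow> c a n < a"
    "\<And>a b. b < a \<Longrightarrow> \<exists>n. b \<le> c a n"
proof -
  define e where "e a = from_nat_into {..<a}" for a :: omega1
  \<comment> \<open>The least ordinal has nothing to enumerate, so its ladder stays at
    \<open>a\<close> itself; hence the strict bound is claimed only if some
    \<open>b < a\<close>.\<close>
  define c where "c a n = (if {..<a} = {} then a else Max (e a ` {..n}))" for a n
  have e_less: "e a n < a" if "b < a" for a b n
    using from_nat_into[of "{..<a}" n] that by (auto simp: e_def)
  have less: "c a n < a" if "b < a" for a b n
    using e_less[OF that] that by (auto simp: c_def)
  show thesis
  proof
    show "mono (c a)" for a
      by (auto simp: c_def intro!: monoI Max_mono)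
    show "c a n < a" if "b < a" for a b n
      using that by (rule less)
    show "c a n \<le> a" for a n
      using less[of _ a n] by (cases "{..<a} = {}") (auto simp: c_def intro: less_imp_le)
    show "\<exists>n. b \<le> c a n" if "b < a" for a b
    proof -
      obtain n where "e a n = b"
        using from_nat_into_surj[OF countable_lessThan_omega1[of a], of b] \<open>b < a\<close>
        unfolding e_def by (metis lessThan_iff)
      then have "b \<le> c a n" using that by (auto simp: c_def intro!: Max_ge)
      then show ?thesis ..
    qed
  qed
qed

section \<open>Construction of the topology\<close>

text \<open>Density of both families lets layers interact: \<open>D\<close> supplies nearby points
  of a lower layer, \<open>I\<close> supplies common points of neighbourhoods.\<close>

locale layers =
  fixes D I :: "omega1 \<Rightarrow> real set" and c :: "omega1 \<Rightarrow> nat \<Rightarrow> omega1"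
  assumes DI: "D a \<inter> I b = {}"
    and DD: "a \<noteq> b \<Longrightarrow> D a \<inter> D b = {}"
    and II: "a \<noteq> b \<Longrightarrow> I a \<inter> I b = {}"
    and countable_D: "countable (D a)"
    and countable_I: "countable (I a)"
    and dense_D: "x < y \<Longrightarrow> \<exists>z\<in>D a. x < z \<and> z < y"
    and dense_I: "x < y \<Longrightarrow> \<exists>z\<in>I a. x < z \<and> z < y"
    and mono_c: "mono (c a)"
    and c_le: "c a n \<le> a"
    and c_less: "b < a \<Longrightarrow> c a n < a"
    and c_cofinal: "b < a \<Longrightarrow> \<exists>n. b \<le> c a n"
begin

text \<open>The point \<open>p\<close> is left out; \<open>insert p (V a p n)\<close> is the basic
  neighbourhood. One index \<open>n\<close> controls both layers and distance, so a single sequence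
  gives a countable base at \<open>p\<close>.\<close>

definition V :: "omega1 \<Rightarrow> real \<Rightarrow> nat \<Rightarrow> real set" where
  "V a p n = (\<Union>b\<in>{c a n..a}. I b) \<inter> ball p (1 / Suc n)"

definition U :: "omega1 \<Rightarrow> real set" where
  "U a = (\<Union>b\<in>{..a}. D b \<union> I b)"

text \<open>Points of the \<open>I a\<close> lie in no \<open>D b\<close>, so they impose no
  condition and become isolated.\<close>

definition T :: "real topology" where
  "T = topology (\<lambda>S. S \<subseteq> (\<Union>a. U a) \<and> (\<forall>a. \<forall>p\<in>D a \<inter> S. \<exists>n. V a p n \<subseteq> S))"

lemma V_antimono: "m \<le> n \<Longrightarrow> V a p n \<subseteq> V a p m"
proof -
  assume "m \<le> n"
  then have "1 / real (Suc n) \<le> 1 / real (Suc m)" "c a m \<le> c a n"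
    using monoD[OF mono_c] by (auto simp: frac_le)
  then show ?thesis
    unfolding V_def by (intro Int_mono UN_mono subset_ball) auto
qed

lemma openin_T:
  "openin T S \<longleftrightarrow> S \<subseteq> (\<Union>a. U a) \<and> (\<forall>a. \<forall>p\<in>D a \<inter> S. \<exists>n. V a p n \<subseteq> S)"
proof -
  let ?P = "\<lambda>S. S \<subseteq> (\<Union>a. U a) \<and> (\<forall>a. \<forall>p\<in>D a \<inter> S. \<exists>n. V a p n \<subseteq> S)"
  have "istopology ?P"
    unfolding istopology_def
  proof (intro conjI; intro allI impI conjI)
    fix A B assume A: "?P A" and B: "?P B"
    show "A \<inter> B \<subseteq> (\<Union>a. U a)" using A by blast
    have "\<exists>n. V a p n \<subseteq> A \<inter> B" if p: "p \<in> D a \<inter> (A \<inter> B)" for a p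
    proof -
      obtain m where "V a p m \<subseteq> A" using A p by blast
      moreover obtain n where "V a p n \<subseteq> B" using B p by blast
      ultimately have "V a p (max m n) \<subseteq> A \<inter> B"
        using V_antimono[of m "max m n" a p] V_antimono[of n "max m n" a p] by auto
      then show ?thesis ..
    qed
    then show "\<forall>p\<in>D a \<inter> (A \<inter> B). \<exists>n. V a p n \<subseteq> A \<inter> B" for a
      by blast
  next
    fix K assume K: "\<forall>A\<in>K. ?P A"
    show "\<Union>K \<subseteq> (\<Union>a. U a)" using K by blast
    show "\<forall>p\<in>D a \<inter> \<Union>K. \<exists>n. V a p n \<subseteq> \<Union>K" for a
    proof
      fix p assume "p \<in> D a \<inter> \<Union>K"
      then obtain A where "A \<in> K" "p \<in> D a \<inter> A" by blast
      then obtain n where "V a p n \<subseteq> A" using K by blast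
      then show "\<exists>n. V a p n \<subseteq> \<Union>K" using \<open>A \<in> K\<close> by blast
    qed
  qed
  then show ?thesis
    by (simp add: T_def topology_inverse')
qed

text \<open>Neighbourhoods of a point of \<open>D b\<close> reach no layer above \<open>b\<close>,
  and disjointness makes the layer of a point unique.\<close>

lemma openin_U: "openin T (U a)"
proof -
  have "V b p 0 \<subseteq> U a" if "p \<in> D b \<inter> U a" for b p
  proof -
    have "b \<le> a"
      using that DD[of b] DI[of b] by (auto simp: U_def) (metis IntI empty_iff)
    then show ?thesis by (fastforce simp: V_def U_def)
  qed
  then show ?thesis by (auto simp: openin_T)
qed

lemma topspace_T: "topspace T = (\<Union>a. U a)"
proof
  show "topspace T \<subseteq> (\<Union>a. U a)"
    using openin_T openin_topspace by blast
  show "(\<Union>a. U a) \<subseteq> topspace T"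
    using openin_U openin_subset by blast
qed

lemma D_subset_T: "D a \<subseteq> topspace T" and I_subset_T: "I a \<subseteq> topspace T"
  by (auto simp: topspace_T U_def)

lemma openin_V: "p \<in> D a \<Longrightarrow> openin T (insert p (V a p n))"
  unfolding openin_T
proof (intro conjI allI ballI)
  assume p: "p \<in> D a"
  then show "insert p (V a p n) \<subseteq> (\<Union>a. U a)"
    by (auto simp: U_def V_def)
  fix b q assume q: "q \<in> D b \<inter> insert p (V a p n)"
  then have "q = p" using DI by (auto simp: V_def)
  then have "b = a" using p q DD[of a b] by auto
  then show "\<exists>n'. V b q n' \<subseteq> insert p (V a p n)"
    using \<open>q = p\<close> by auto
qed

lemma openin_isolated: "p \<in> I a \<Longrightarrow> openin T {p}"
  using DI by (fastforce simp: openin_T U_def)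

lemma openin_euclidean: "open S \<Longrightarrow> openin T (topspace T \<inter> S)"
  unfolding openin_T
proof (intro conjI allI ballI)
  fix a p assume S: "open S" and p: "p \<in> D a \<inter> (topspace T \<inter> S)"
  then obtain e where e: "e > 0" "ball p e \<subseteq> S"
    using openE by blast
  obtain n where "1 / real (Suc n) < e"
    using e(1) nat_approx_posE by blast
  then have "ball p (1 / Suc n) \<subseteq> S"
    using e(2) by auto
  then have "V a p n \<subseteq> topspace T \<inter> S"
    using I_subset_T by (auto simp: V_def)
  then show "\<exists>n. V a p n \<subseteq> topspace T \<inter> S" ..
qed (auto simp: topspace_T)

lemma continuous_map_euclidean:
  fixes f :: "real \<Rightarrow> 'b :: topological_space"
  assumes "continuous_on UNIV f"
  shows "continuous_map T euclidean f"
  unfolding continuous_map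
proof (intro conjI allI impI)
  fix S :: "'b set" assume "openin euclidean S"
  then have "open (f -` S)" using assms by (simp add: open_vimage)
  moreover have "{x \<in> topspace T. f x \<in> S} = topspace T \<inter> f -` S" by auto
  ultimately show "openin T {x \<in> topspace T. f x \<in> S}"
    using openin_euclidean by simp
qed auto

section \<open>Separation and first countability\<close>

lemma Hausdorff_T: "Hausdorff_space T"
  unfolding Hausdorff_space_def
proof (intro allI impI, elim conjE)
  fix x y assume xy: "x \<in> topspace T" "y \<in> topspace T" "x \<noteq> y"
  then obtain A B where AB: "open A" "open B" "x \<in> A" "y \<in> B" "A \<inter> B = {}"
    using hausdorff[OF xy(3)] by blast
  have "disjnt (topspace T \<inter> A) (topspace T \<inter> B)"
    using AB(5) by (auto simp: disjnt_def)
  then show "\<exists>A B. openin T A \<and> openin T B \<and> x \<in> A \<and> y \<in> B \<and> disjnt A B"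
    using xy(1,2) AB(3,4) openin_euclidean[OF AB(1)] openin_euclidean[OF AB(2)] by blast
qed

lemma functionally_Hausdorff_T: "functionally_Hausdorff_space T"
  unfolding functionally_Hausdorff_space_def
proof (intro ballI impI)
  fix x y :: real assume "x \<noteq> y"
  then show "\<exists>f. continuous_map T euclideanreal f \<and> f x = 0 \<and> f y = 1"
    by (intro exI[of _ "\<lambda>t. (t - x) / (y - x)"] conjI continuous_map_euclidean continuous_intros) auto
qed

lemma first_countable_T: "first_countable T"
  unfolding first_countable_def
proof
  fix x assume "x \<in> topspace T"
  then consider a where "x \<in> D a" | a where "x \<in> I a"
    by (auto simp: topspace_T U_def)
  then show "\<exists>B. countable B \<and> (\<forall>W\<in>B. openin T W) \<and>
      (\<forall>A. openin T A \<and> x \<in> A \<longrightarrow> (\<exists>W\<in>B. x \<in> W \<and> W \<subseteq> A))"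
  proof cases
    case 1
    show ?thesis
    proof (intro exI[of _ "range (\<lambda>n. insert x (V a x n))"] conjI allI impI)
      fix A assume A: "openin T A \<and> x \<in> A"
      then obtain n where "V a x n \<subseteq> A"
        using 1 openin_T by blast
      then show "\<exists>W\<in>range (\<lambda>n. insert x (V a x n)). x \<in> W \<and> W \<subseteq> A"
        using A by auto
    qed (use openin_V[OF 1] in auto)
  next
    case 2
    then show ?thesis
      using openin_isolated by (intro exI[of _ "{{x}}"]) auto
  qed
qed

section \<open>The Type I cover\<close>

lemma countable_U: "countable (U a)"
proof -
  have "{..a} = insert a {..<a}" by auto
  then have "countable {..a}"
    using countable_lessThan_omega1[of a] by simp
  then show ?thesis
    unfolding U_def using countable_D countable_I by blast
qed

lemma U_mono: "a \<le> b \<Longrightarrow> U a \<subseteq> U b"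
  by (auto simp: U_def intro: order_trans)

lemma D_Int_U: "a < b \<Longrightarrow> D b \<inter> U a = {}"
  using DD[of b] DI[of b] by (auto simp: U_def) (metis IntI empty_iff leD)+

text \<open>A point of \<open>D d\<close> with \<open>d > b\<close> has a neighbourhood whose other
  points lie in layers from \<open>b\<close> up, hence above \<open>a\<close>. Isolated points in
  the closure already belong to \<open>U a\<close>.\<close>

lemma closure_U_subset:
  assumes "a < b"
  shows "T closure_of U a \<subseteq> U b"
proof
  fix q assume q: "q \<in> T closure_of U a"
  then have "q \<in> topspace T"
    by (simp add: in_closure_of)
  then consider d where "q \<in> D d" "d \<le> b" | d where "q \<in> D d" "b < d" | d where "q \<in> I d"
    by (auto simp: topspace_T U_def) (metis linorder_not_le)
  then show "q \<in> U b"
  proof cases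
    case 1
    then show ?thesis by (auto simp: U_def)
  next
    case 2
    obtain n where n: "b \<le> c d n"
      using c_cofinal 2(2) by blast
    obtain z where z: "z \<in> U a" "z \<in> insert q (V d q n)"
      using q openin_V[OF 2(1)] unfolding in_closure_of by (metis insertI1)
    then have "z \<in> V d q n"
      using D_Int_U[of a d] 2 assms by (auto dest: less_trans)
    then obtain e where "z \<in> I e" "b \<le> e"
      using n by (auto simp: V_def)
    moreover obtain e' where "z \<in> I e'" "e' \<le> a"
      using z(1) DI \<open>z \<in> I e\<close> by (auto simp: U_def)
    moreover have "e \<noteq> e'"
      using \<open>b \<le> e\<close> \<open>e' \<le> a\<close> assms by auto
    ultimately have False
      using II[of e e'] by blast
    then show ?thesis ..
  next
    case 3
    then have "q \<in> U a"
      using q openin_isolated[OF 3] unfolding in_closure_of by blast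
    then show ?thesis
      using U_mono[of a b] assms less_imp_le by blast
  qed
qed

lemma type_I_T: "type_I_space T"
  unfolding type_I_space_def
proof (intro exI[of _ U] conjI allI impI)
  fix a :: omega1
  \<comment> \<open>The closure lies in the countable set \<open>U b\<close>, and countable spaces
    are Lindelof.\<close>
  obtain b where "a < b" using omega1_not_top by blast
  then have "countable (T closure_of U a)"
    using closure_U_subset countable_U countable_subset by blast
  then show "Lindelof_space (subtopology T (T closure_of U a))"
    by (intro countable_imp_Lindelof_space) (simp add: countable_Int2)
qed (use openin_U topspace_T closure_U_subset in auto)

section \<open>Failure of f-Type I\<close>

text \<open>
  Neighbourhoods of \<open>p \<in> D a\<close> and of any nearby point of \<open>D (c a n)\<close> both contain points of
  \<open>I (c a n)\<close>, so a bound on \<open>s\<close> over the lower layers persists at \<open>p\<close>.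
\<close>
lemma bounded_layers:
  fixes s :: "real \<Rightarrow> 'b :: {linorder, order_topology}"
  assumes s: "continuous_map T euclidean s"
    and bound: "\<And>p. p \<in> D (LEAST a. True) \<Longrightarrow> s p \<le> l"
  shows "p \<in> D a \<Longrightarrow> s p \<le> l"
proof (induction a arbitrary: p rule: less_induct)
  case (less a)
  have op: "openin T {x \<in> topspace T. s x \<in> S}" if "open S" for S
    using s that by (simp add: continuous_map)
  show ?case
  proof (cases "a = (LEAST a. True)")
    case True
    then show ?thesis using less.prems bound by simp
  next
    case False
    \<comment> \<open>\<open>LEAST a. True\<close> is the zero of \<open>omega1\<close>. Above it
      the ladder stays strictly below \<open>a\<close>, so the induction hypothesis applies to the
      layer \<open>c a n\<close>.\<close>
    then have pos: "(LEAST a. True) < a"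
      by (simp add: Least_le order.not_eq_order_implies_strict)
    show ?thesis
    proof (rule ccontr)
      assume "\<not> s p \<le> l"
      then have "l < s p" by simp
      \<comment> \<open>Disjoint open sets separate \<open>{..l}\<close> from \<open>s p\<close>:
        cut at a point in between, or, across a gap, use the rays \<open>{..<s p}\<close> and
        \<open>{l<..}\<close>.\<close>
      then obtain A B where AB: "open A" "open B" "{..l} \<subseteq> A" "s p \<in> B" "A \<inter> B = {}"
      proof (cases "\<exists>d. l < d \<and> d < s p")
        case True
        then obtain d where "l < d" "d < s p" by blast
        then show ?thesis using that[of "{..<d}" "{d<..}"] by fastforce
      next
        case False
        then show ?thesis using that[of "{..<s p}" "{l<..}"] \<open>l < s p\<close> by fastforce
      qed
      have "p \<in> topspace T" using less.prems D_subset_T by blast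
      then obtain n where n: "V a p n \<subseteq> {x \<in> topspace T. s x \<in> B}"
        using op[OF AB(2)] less.prems AB(4) unfolding openin_T by blast
      let ?b = "c a n"
      obtain q where q: "q \<in> D ?b" "p - 1 / Suc n < q" "q < p + 1 / Suc n"
        using dense_D[of "p - 1 / Suc n" "p + 1 / Suc n" ?b] by auto
      then have "s q \<in> A"
        using less.IH[OF c_less[OF pos]] AB(3) by auto
      moreover have "q \<in> topspace T" using q(1) D_subset_T by blast
      ultimately obtain m where m: "V ?b q m \<subseteq> {x \<in> topspace T. s x \<in> A}"
        using op[OF AB(1)] q(1) unfolding openin_T by blast
      obtain z where z: "z \<in> I ?b" "q < z" "z < min (q + 1 / Suc m) (p + 1 / Suc n)"
        using dense_I[of q "min (q + 1 / Suc m) (p + 1 / Suc n)" ?b] q(3) by auto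
      \<comment> \<open>The layer \<open>?b\<close> is the bottom of the interval
        \<open>{c a n..a}\<close> and the top of \<open>{c ?b m..?b}\<close>, so both neighbourhoods
        use \<open>I ?b\<close>.\<close>
      have "z \<in> V a p n" "z \<in> V ?b q m"
        using z q c_le by (auto simp: V_def dist_real_def abs_if intro!: bexI[of _ ?b])
      then show False using m n AB(5) by auto
    qed
  qed
qed

text \<open>Some preimage of an initial segment contains every \<open>D d\<close>. Countably many
  \<open>U j\<close> cannot cover it: their indices are bounded by some \<open>e\<close>, and
  \<open>D d\<close> with \<open>d > e\<close> is nonempty and misses them all.\<close>

lemma not_f_type_I_T: "\<not> f_type_I_space T"
proof
  assume "f_type_I_space T"
  then obtain s :: "real \<Rightarrow> longray" where s: "continuous_map T euclidean s"
    and Lind: "\<And>a. Lindelof_space (subtopology T {x \<in> topspace T. s x \<in> {..longray_of_omega1 a}})"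
    unfolding f_type_I_space_def by blast
  let ?h = "\<lambda>p. fst (Rep_longray (s p))"
  have "countable (?h ` D (LEAST a. True))"
    using countable_D by simp
  then obtain b where b: "\<forall>x\<in>?h ` D (LEAST a. True). x \<le> b"
    using countable_bounded_above_omega1 by blast
  \<comment> \<open>Values of \<open>s\<close> with first coordinate \<open>b\<close> may exceed
    \<open>(b, 0)\<close> but lie below \<open>(a, 0)\<close>.\<close>
  obtain a where "b < a" using omega1_not_top by blast
  then have "s p \<le> longray_of_omega1 a" if "p \<in> D (LEAST a. True)" for p
  proof -
    have "?h p \<le> b" using b that by blast
    with \<open>b < a\<close> show ?thesis
      by (auto simp: less_eq_longray_def Rep_longray_of_omega1)
  qed
  then have bound: "D d \<subseteq> {x \<in> topspace T. s x \<in> {..longray_of_omega1 a}}" (is "_ \<subseteq> ?S") for d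
    using bounded_layers[OF s] D_subset_T by blast
  have S: "?S \<subseteq> topspace T" by auto
  have "(\<forall>W\<in>range U. openin T W) \<and> ?S \<subseteq> \<Union> (range U)"
    using openin_U by (auto simp: topspace_T)
  then have "\<exists>K. countable K \<and> K \<subseteq> range U \<and> ?S \<subseteq> \<Union>K"
    by (rule iffD1[OF Lindelof_space_subtopology_subset[OF S] Lind[of a], rule_format])
  then obtain K where K: "countable K" "K \<subseteq> range U" "?S \<subseteq> \<Union>K"
    by blast
  obtain J where J: "countable J" "K = U ` J"
    using K(1,2) countable_subset_image[of K U UNIV] by blast
  then obtain e where e: "\<forall>j\<in>J. j \<le> e"
    using countable_bounded_above_omega1 by blast
  obtain d where "e < d" using omega1_not_top by blast
  obtain z where z: "z \<in> D d" using dense_D[of 0 1 d] by auto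
  then obtain j where "j \<in> J" "z \<in> U j"
    using bound[of d] K(3) J(2) by blast
  moreover from \<open>j \<in> J\<close> have "j < d"
    using e \<open>e < d\<close> by (meson le_less_trans)
  ultimately show False
    using D_Int_U[of j d] z by blast
qed

end

theorem mainTheorem2:
  shows "\<exists>T :: real topology.
    Hausdorff_space T \<and> first_countable T \<and> functionally_Hausdorff_space T \<and>
    type_I_space T \<and> \<not> f_type_I_space T"
proof -
  obtain C :: "omega1 \<times> bool \<Rightarrow> real set" where C: "disjoint_family C" "\<And>i. countable (C i)"
    "\<And>i x y. x < y \<Longrightarrow> \<exists>z\<in>C i. x < z \<and> z < y"
    by (rule disjoint_countable_dense_sets) blast
  obtain c :: "omega1 \<Rightarrow> nat \<Rightarrow> omega1" where c: "\<And>a. mono (c a)" "\<And>a n. c a n \<le> a"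
    "\<And>a b n. b < a \<Longrightarrow> c a n < a" "\<And>a b. b < a \<Longrightarrow> \<exists>n. b \<le> c a n"
    by (rule omega1_ladder) blast
  have disj: "C i \<inter> C j = {}" if "i \<noteq> j" for i j
    using C(1) that unfolding disjoint_family_on_def by blast
  \<comment> \<open>The boolean splits one disjoint family into the \<open>D\<close> sets and the
    \<open>I\<close> sets.\<close>
  interpret layers "\<lambda>a. C (a, True)" "\<lambda>a. C (a, False)" c
    by standard (use disj C c in auto)
  show ?thesis
    using Hausdorff_T first_countable_T functionally_Hausdorff_T type_I_T not_f_type_I_T by blast
qed

end
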